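(* Every nonempty closed and geodesically convex subspace $A$ of $\mathbb{R}^2_{\infty}$ (with the metric induced from $\mathbb{R}^2_\infty$) is hyperconvex.
   Context: $\mathbb{R}^2_{\infty}$ denotes $\mathbb{R}^2$ with the maximum metric $d_{\infty}((p_1,p_2),(q_1,q_2))=\max\{|p_1-q_1|,|p_2-q_2|\}$. A geodesic between $p$ and $q$ in $\mathbb{R}^2_\infty$ is a path from $p$ to $q$ whose length equals $d_\infty(p,q)$, parameterized by arc length. A subset $A\subseteq\mathbb{R}^2_{\infty}$ is called geodesically convex if for any two points $p,q\in A$ there exists a geodesic in $\mathbb{R}^2_\infty$ between $p$ and $q$ which is contained in $A$. A metric space $(X,d)$ is called hyperconvex if for any collection $(x_i)_{i\in I}$ of points in $X$ and any collection $(r_i)_{i\in I}$ of nonnegative real numbers satisfying $d(x_i,x_j)\le r_i+r_j$ for all $i,j\in I$, one has $\bigcap_{i\in I}\bar B(x_i,r_i)\neq\emptyset$, where $\bar B(x_i,r_i)=\{x\in X\mid d(x_i,x)\le r_i\}$. *)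

theory Defs
  imports "HOL-Analysis.Analysis"
begin

context Metric_space
begin

definition curve_length :: "(real \<Rightarrow> 'a) \<Rightarrow> real \<Rightarrow> real \<Rightarrow> ennreal" where
  "curve_length g a b =
     (SUP ts \<in> {ts. sorted ts \<and> set ts \<subseteq> {a..b}}.
        \<Sum>i < length ts - 1. ennreal (d (g (ts ! i)) (g (ts ! Suc i))))"

definition geodesic :: "(real \<Rightarrow> 'a) \<Rightarrow> real \<Rightarrow> 'a \<Rightarrow> 'a \<Rightarrow> bool" where
  "geodesic g l p q \<longleftrightarrow>
     0 \<le> l \<and> continuous_map (top_of_set {0..l}) mtopology g \<and> g 0 = p \<and> g l = q \<and>
     curve_length g 0 l = ennreal (d p q) \<and>
     (\<forall>s t. 0 \<le> s \<and> s \<le> t \<and> t \<le> l \<longrightarrow> curve_length g s t = ennreal (t - s))"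

definition geodesically_convex :: "'a set \<Rightarrow> bool" where
  "geodesically_convex A \<longleftrightarrow>
     A \<subseteq> M \<and> (\<forall>p\<in>A. \<forall>q\<in>A. \<exists>g l. geodesic g l p q \<and> g ` {0..l} \<subseteq> A)"

text \<open>A definition cannot quantify over index types. Indexing by subsets of \<open>'a \<times> real\<close>
  loses nothing, since a family may be replaced by the set of its pairs (centre, radius);
  \<open>hyperconvexD\<close> below recovers arbitrary index types. The explicit intersection with the
  carrier only matters for the empty family.\<close>

definition hyperconvex :: bool where
  "hyperconvex \<longleftrightarrow>
     (\<forall>(I :: ('a \<times> real) set) x r.
        (\<forall>i\<in>I. x i \<in> M \<and> 0 \<le> r i) \<longrightarrow>
        (\<forall>i\<in>I. \<forall>j\<in>I. d (x i) (x j) \<le> r i + r j) \<longrightarrow>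
        M \<inter> (\<Inter>i\<in>I. mcball (x i) (r i)) \<noteq> {})"

lemma hyperconvexD:
  fixes I :: "'i set"
  assumes "hyperconvex"
    and "\<And>i. i \<in> I \<Longrightarrow> x i \<in> M \<and> 0 \<le> r i"
    and "\<And>i j. i \<in> I \<Longrightarrow> j \<in> I \<Longrightarrow> d (x i) (x j) \<le> r i + r j"
  shows "M \<inter> (\<Inter>i\<in>I. mcball (x i) (r i)) \<noteq> {}"
proof -
  let ?J = "(\<lambda>i. (x i, r i)) ` I"
  have "M \<inter> (\<Inter>j\<in>?J. mcball (fst j) (snd j)) \<noteq> {}"
    by (rule assms(1)[unfolded hyperconvex_def, rule_format]) (use assms(2,3) in auto)
  then show ?thesis
    by simp
qed

end

definition dmax :: "real \<times> real \<Rightarrow> real \<times> real \<Rightarrow> real" where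
  "dmax p q = max \<bar>fst p - fst q\<bar> \<bar>snd p - snd q\<bar>"

interpretation dmax: Metric_space UNIV dmax
  by unfold_locales (auto simp: dmax_def)

end

theory Submission
  imports Defs
begin

text \<open>
  A family of balls \<open>B(x\<^sub>i, r\<^sub>i)\<close> centred in \<open>A\<close> has a common point in \<open>A\<close> iff the function
  \<open>f z = sup\<^sub>i (d(x\<^sub>i, z) - r\<^sub>i)\<close> takes a value \<open>\<le> 0\<close> on \<open>A\<close>. By compactness it suffices to treat
  finite families, and then \<open>f\<close> attains its minimum over \<open>A\<close>, at a point \<open>y\<close> say. The proof shows
  that if \<open>t = f y\<close> were positive, then \<open>f\<close> could be decreased further inside \<open>A\<close>
  (\<open>descent\<close>).

  Put \<open>\<rho>\<^sub>i = r\<^sub>i + t\<close>, so that \<open>y\<close> lies in all squares \<open>B(x\<^sub>i, \<rho>\<^sub>i)\<close> while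
  \<open>d(x\<^sub>i, x\<^sub>j) < \<rho>\<^sub>i + \<rho>\<^sub>j\<close>. Because of the strict inequality, \<open>y\<close> cannot lie both on a left side
  of one of the squares and on a right side of another, and similarly for top and bottom
  (\<open>one_dimensional_contact\<close>). If \<open>y\<close> lies only on vertical sides, or only on horizontal ones, an
  initial piece of a geodesic from \<open>y\<close> to the centre of such a square leads into the interior of
  all squares (\<open>step_fst\<close>, \<open>step_snd\<close>). The essential case is the one where \<open>y\<close> meets both a
  vertical side, of a square with centre \<open>p\<close>, and a horizontal side, of a square with centre
  \<open>q\<close>. There a geodesic towards \<open>p\<close> may leave the square around \<open>q\<close> and vice versa, but a
  diagonal step enters both squares. A geodesic in \<open>A\<close> from \<open>p\<close> to \<open>q\<close> has to cross
  the diagonal line through \<open>y\<close>, and since \<open>d(p, q)\<close> falls short of \<open>\<rho>\<^sub>p + \<rho>\<^sub>q\<close> by at least \<open>2 * t\<close>, it does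
  so at distance at least \<open>t\<close> from \<open>y\<close>. Geodesics between points of a diagonal line are unique, so
  the diagonal segment from \<open>y\<close> to the crossing point is in \<open>A\<close> (\<open>step_diagonal\<close>).
\<close>

section \<open>Geodesics in the maximum metric\<close>

lemma abs_fst_le_dmax: "\<bar>fst p - fst q\<bar> \<le> dmax p q"
  and abs_snd_le_dmax: "\<bar>snd p - snd q\<bar> \<le> dmax p q"
  by (auto simp: dmax_def)

lemma dmax_le_dist: "dmax p q \<le> dist p q"
  using dist_fst_le[of p q] dist_snd_le[of p q] by (auto simp: dmax_def dist_real_def)

lemma dist_le_dmax: "dist p q \<le> 2 * dmax p q"
  using sqrt_sum_squares_le_sum_abs[of "fst p - fst q" "snd p - snd q"]
    abs_fst_le_dmax[of p q] abs_snd_le_dmax[of p q]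
  by (simp add: dist_prod_def dist_real_def)

lemma continuous_on_dmax [continuous_intros]:
  assumes "continuous_on S f" "continuous_on S g"
  shows "continuous_on S (\<lambda>x. dmax (f x) (g x))"
  unfolding dmax_def by (intro continuous_intros assms)

text \<open>The maximum metric is equivalent to the Euclidean one, which gives access to the
  compactness theorems for the standard topology.\<close>

lemma closed_if_closedin_dmax:
  assumes "closedin dmax.mtopology A"
  shows "closed A"
proof -
  have "\<exists>r>0. ball z r \<subseteq> - A" if "z \<in> - A" for z
  proof -
    have "z \<in> UNIV - A"
      using that by simp
    then obtain r where "r > 0" "disjnt A (dmax.mball z r)"
      using assms unfolding dmax.closedin_metric by blast
    moreover have "ball z r \<subseteq> dmax.mball z r"
      using order_le_less_trans[OF dmax_le_dist[of z]] by (simp add: subset_iff)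
    ultimately have "ball z r \<subseteq> - A"
      unfolding disjnt_iff by blast
    with \<open>r > 0\<close> show ?thesis by blast
  qed
  then show ?thesis
    by (simp add: closed_def open_contains_ball)
qed

lemma (in Metric_space) dist_le_curve_length:
  assumes "a \<le> s" "s \<le> t" "t \<le> b"
  shows "ennreal (d (g s) (g t)) \<le> curve_length g a b"
  unfolding curve_length_def
  by (rule SUP_upper2[where i = "[s, t]"]) (use assms in auto)

text \<open>All that is used of a geodesic: it is continuous, and the triangle inequality is an equality
  along it.\<close>

definition geodesic_subset :: "(real \<times> real) set \<Rightarrow> bool" where
  "geodesic_subset A \<longleftrightarrow>
     (\<forall>p\<in>A. \<forall>q\<in>A. \<exists>g. continuous_on {0..dmax p q} g \<and> g 0 = p \<and> g (dmax p q) = q \<and>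
        (\<forall>s\<in>{0..dmax p q}. g s \<in> A \<and> dmax p (g s) = s \<and> dmax (g s) q = dmax p q - s))"

lemma geodesic_subsetE:
  assumes "geodesic_subset A" "p \<in> A" "q \<in> A"
  obtains g where "continuous_on {0..dmax p q} g" "g 0 = p" "g (dmax p q) = q"
    "\<And>s. 0 \<le> s \<Longrightarrow> s \<le> dmax p q \<Longrightarrow> g s \<in> A \<and> dmax p (g s) = s \<and> dmax (g s) q = dmax p q - s"
proof -
  obtain g where "continuous_on {0..dmax p q} g \<and> g 0 = p \<and> g (dmax p q) = q \<and>
        (\<forall>s\<in>{0..dmax p q}. g s \<in> A \<and> dmax p (g s) = s \<and> dmax (g s) q = dmax p q - s)"
    using assms unfolding geodesic_subset_def by blast
  with that[of g] show thesis by simp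
qed

lemma geodesic_subset_if_geodesically_convex:
  assumes "dmax.geodesically_convex A"
  shows "geodesic_subset A"
  unfolding geodesic_subset_def
proof (intro ballI)
  fix p q assume "p \<in> A" "q \<in> A"
  then obtain g l where g: "dmax.geodesic g l p q" and gA: "g ` {0..l} \<subseteq> A"
    using assms unfolding dmax.geodesically_convex_def by blast
  have l: "0 \<le> l" "g 0 = p" "g l = q"
    and len: "dmax.curve_length g 0 l = ennreal (dmax p q)"
    and seg: "\<And>s t. 0 \<le> s \<Longrightarrow> s \<le> t \<Longrightarrow> t \<le> l \<Longrightarrow> dmax.curve_length g s t = ennreal (t - s)"
    using g unfolding dmax.geodesic_def by auto
  have l_eq: "l = dmax p q"
    using len seg[of 0 l] l(1) by simp
  have lip: "dmax (g s) (g t) \<le> t - s" if "0 \<le> s" "s \<le> t" "t \<le> l" for s t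
    using dmax.dist_le_curve_length[of s s t t g] seg[OF that] that by simp
  have "continuous_on {0..l} g"
  proof (rule continuous_onI)
    fix s e :: real assume "s \<in> {0..l}" "0 < e"
    moreover have "dist (g s') (g s) \<le> e" if "s' \<in> {0..l}" "dist s' s < e / 2" for s'
    proof -
      have "dmax (g s') (g s) \<le> \<bar>s' - s\<bar>"
        using lip[of s s'] lip[of s' s] that \<open>s \<in> {0..l}\<close> dmax.commute[of "g s" "g s'"]
        by (cases "s \<le> s'") auto
      then show ?thesis
        using dist_le_dmax[of "g s'" "g s"] that by (simp add: dist_real_def)
    qed
    ultimately show "\<exists>d>0. \<forall>s'\<in>{0..l}. dist s' s < d \<longrightarrow> dist (g s') (g s) \<le> e"
      by (intro exI[of _ "e / 2"]) auto
  qed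
  moreover have "g s \<in> A \<and> dmax p (g s) = s \<and> dmax (g s) q = l - s" if "s \<in> {0..l}" for s
    using lip[of 0 s] lip[of s l] that l gA l_eq dmax.triangle[of p "g s" q] by auto
  ultimately show "\<exists>g. continuous_on {0..dmax p q} g \<and> g 0 = p \<and> g (dmax p q) = q \<and>
        (\<forall>s\<in>{0..dmax p q}. g s \<in> A \<and> dmax p (g s) = s \<and> dmax (g s) q = dmax p q - s)"
    using l l_eq by blast
qed

section \<open>Moving inside a geodesic subset\<close>

text \<open>A sign \<open>\<sigma>\<close> or \<open>\<tau>\<close> says on which side of \<open>y\<close> a point lies. A geodesic of length
  \<open>\<sigma> * (fst p - fst y)\<close> moves with full speed in the first coordinate.\<close>

lemma step_fst:
  assumes "geodesic_subset A" "y \<in> A" "p \<in> A" "\<sigma> \<in> {-1, 1}"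
    and "\<sigma> * (fst p - fst y) = dmax p y" "0 \<le> \<epsilon>" "\<epsilon> \<le> dmax p y"
  obtains z where "z \<in> A" "fst z = fst y + \<sigma> * \<epsilon>" "\<bar>snd z - snd y\<bar> \<le> \<epsilon>"
proof -
  obtain z where "z \<in> A" and z: "dmax y z = \<epsilon>" "dmax z p = dmax y p - \<epsilon>"
    using assms geodesic_subsetE[OF assms(1-3)] dmax.commute by metis
  then have "fst z = fst y + \<sigma> * \<epsilon>" "\<bar>snd z - snd y\<bar> \<le> \<epsilon>"
    using abs_fst_le_dmax[of y z] abs_snd_le_dmax[of y z] abs_fst_le_dmax[of z p]
      dmax.commute[of p y] assms(4-) by auto
  with \<open>z \<in> A\<close> show ?thesis by (rule that)
qed

lemma step_snd:
  assumes "geodesic_subset A" "y \<in> A" "q \<in> A" "\<tau> \<in> {-1, 1}"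
    and "\<tau> * (snd q - snd y) = dmax q y" "0 \<le> \<epsilon>" "\<epsilon> \<le> dmax q y"
  obtains z where "z \<in> A" "snd z = snd y + \<tau> * \<epsilon>" "\<bar>fst z - fst y\<bar> \<le> \<epsilon>"
proof -
  obtain z where "z \<in> A" and z: "dmax y z = \<epsilon>" "dmax z q = dmax y q - \<epsilon>"
    using assms geodesic_subsetE[OF assms(1-3)] dmax.commute by metis
  then have "snd z = snd y + \<tau> * \<epsilon>" "\<bar>fst z - fst y\<bar> \<le> \<epsilon>"
    using abs_snd_le_dmax[of y z] abs_fst_le_dmax[of y z] abs_snd_le_dmax[of z q]
      dmax.commute[of q y] assms(4-) by auto
  with \<open>z \<in> A\<close> show ?thesis by (rule that)
qed

text \<open>The points \<open>p\<close> and \<open>q\<close> lie (weakly) on different sides of the diagonal line of direction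
  \<open>(\<sigma>, \<tau>)\<close> through \<open>y\<close>, so a geodesic from \<open>p\<close> to \<open>q\<close> crosses this line, at
  \<open>y + w * (\<sigma>, \<tau>)\<close> say. The two parts of the geodesic have length at least \<open>dmax p y - w\<close> and
  \<open>dmax q y - w\<close>, which forces \<open>t \<le> w\<close>. A geodesic between two points of a diagonal line runs
  at full speed in both coordinates and hence stays on the line.\<close>

lemma step_diagonal:
  assumes A: "geodesic_subset A" "y \<in> A" "p \<in> A" "q \<in> A"
    and \<sigma>\<tau>: "\<sigma> \<in> {-1, 1}" "\<tau> \<in> {-1, 1}"
    and p: "\<sigma> * (fst p - fst y) = dmax p y"
    and q: "\<tau> * (snd q - snd y) = dmax q y"
    and gap: "dmax p q \<le> dmax p y + dmax q y - 2 * t"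
    and \<epsilon>: "0 \<le> \<epsilon>" "\<epsilon> \<le> t"
  shows "(fst y + \<sigma> * \<epsilon>, snd y + \<tau> * \<epsilon>) \<in> A"
proof -
  \<comment> \<open>\<open>h\<close> vanishes exactly on the diagonal line.\<close>
  define h where "h z = \<sigma> * (fst z - fst y) - \<tau> * (snd z - snd y)" for z
  obtain g where g: "continuous_on {0..dmax p q} g" "g 0 = p" "g (dmax p q) = q"
    "\<And>s. 0 \<le> s \<Longrightarrow> s \<le> dmax p q \<Longrightarrow> g s \<in> A \<and> dmax p (g s) = s \<and> dmax (g s) q = dmax p q - s"
    using geodesic_subsetE[OF A(1,3,4)] by blast
  have "h p \<ge> 0"
    using abs_snd_le_dmax[of p y] p \<sigma>\<tau> by (auto simp: h_def)
  moreover have "h q \<le> 0"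
    using abs_fst_le_dmax[of q y] q \<sigma>\<tau> by (auto simp: h_def)
  moreover have "continuous_on {0..dmax p q} (\<lambda>s. h (g s))"
    unfolding h_def by (intro continuous_intros g(1))
  ultimately obtain s where s: "0 \<le> s" "s \<le> dmax p q" "h (g s) = 0"
    using IVT2'[of "\<lambda>s. h (g s)" "dmax p q" 0 0] g(2,3) by auto
  define w where "w = \<sigma> * (fst (g s) - fst y)"
  define c where "c = g s"
  have c: "c \<in> A" "fst c = fst y + \<sigma> * w" "snd c = snd y + \<tau> * w"
    using g(4)[OF s(1,2)] s(3) \<sigma>\<tau> by (auto simp: c_def w_def h_def)
  have "dmax p c + dmax c q = dmax p q"
    using g(4)[OF s(1,2)] by (simp add: c_def)
  moreover have "dmax p c \<ge> dmax p y - w"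
    using abs_fst_le_dmax[of p c] p c \<sigma>\<tau> by auto
  moreover have "dmax c q \<ge> dmax q y - w"
    using abs_snd_le_dmax[of c q] q c \<sigma>\<tau> by auto
  ultimately have "t \<le> w"
    using gap by linarith
  then have yc: "dmax y c = w"
    using c \<epsilon> \<sigma>\<tau> by (auto simp: dmax_def)
  obtain z where z: "z \<in> A" "dmax y z = \<epsilon>" "dmax z c = w - \<epsilon>"
    using geodesic_subsetE[OF A(1,2) c(1)] yc \<epsilon> \<open>t \<le> w\<close> by (metis order.trans)
  then have "fst z = fst y + \<sigma> * \<epsilon>" "snd z = snd y + \<tau> * \<epsilon>"
    using abs_fst_le_dmax[of y z] abs_snd_le_dmax[of y z] abs_fst_le_dmax[of z c]
      abs_snd_le_dmax[of z c] c \<sigma>\<tau> by auto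
  with z(1) show ?thesis
    by (metis prod.collapse)
qed

section \<open>Descent towards the intersection of the balls\<close>

lemma finite_positive_lower_bound:
  fixes c :: "'i \<Rightarrow> real"
  assumes "finite I" "\<forall>i\<in>I. 0 < c i"
  shows "\<exists>\<delta>>0. \<forall>i\<in>I. \<delta> < c i"
  using assms
proof (induction I)
  case empty
  show ?case using zero_less_one by blast
next
  case (insert k I)
  then obtain \<delta> where "0 < \<delta>" "\<forall>i\<in>I. \<delta> < c i" by auto
  with insert.prems show ?case
    by (intro exI[of _ "min \<delta> (c k / 2)"]) auto
qed

text \<open>The origin lies in all intervals \<open>[a\<^sub>i - \<rho>\<^sub>i, a\<^sub>i + \<rho>\<^sub>i]\<close>. Either it is interior to all of them, or
  it is an end point of some. As any two intervals overlap in more than one point, it is then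
  never a left and a right end point at once, and small steps in the direction \<open>\<sigma>\<close> lead into the
  interior of all intervals.\<close>

lemma one_dimensional_contact:
  fixes a \<rho> :: "'i \<Rightarrow> real"
  assumes "finite I"
    and le: "\<forall>i\<in>I. \<bar>a i\<bar> \<le> \<rho> i"
    and less: "\<forall>i\<in>I. \<forall>j\<in>I. \<bar>a i - a j\<bar> < \<rho> i + \<rho> j"
  obtains
    (interior) \<delta> where "0 < \<delta>" "\<And>i h. i \<in> I \<Longrightarrow> \<bar>h\<bar> \<le> \<delta> \<Longrightarrow> \<bar>a i - h\<bar> < \<rho> i"
  | (contact) \<sigma> \<delta> k where "0 < \<delta>" "\<sigma> \<in> {-1, 1}" "k \<in> I" "\<sigma> * a k = \<rho> k"
      "\<And>i \<epsilon>. i \<in> I \<Longrightarrow> 0 < \<epsilon> \<Longrightarrow> \<epsilon> \<le> \<delta> \<Longrightarrow> \<bar>a i - \<sigma> * \<epsilon>\<bar> < \<rho> i"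
proof (cases "\<exists>k\<in>I. \<bar>a k\<bar> = \<rho> k")
  case False
  with le have "\<forall>i\<in>I. 0 < \<rho> i - \<bar>a i\<bar>"
    by (metis diff_gt_0_iff_gt order_le_imp_less_or_eq)
  from finite_positive_lower_bound[OF \<open>finite I\<close> this]
  obtain \<delta> where "0 < \<delta>" and \<delta>: "\<forall>i\<in>I. \<delta> < \<rho> i - \<bar>a i\<bar>"
    by auto
  show thesis
  proof (rule interior[OF \<open>0 < \<delta>\<close>])
    show "\<bar>a i - h\<bar> < \<rho> i" if "i \<in> I" "\<bar>h\<bar> \<le> \<delta>" for i h
      using bspec[OF \<delta> that(1)] that(2) by linarith
  qed
next
  case True
  then obtain k where k: "k \<in> I" "\<bar>a k\<bar> = \<rho> k" by blast
  define \<sigma> :: real where "\<sigma> = (if a k = \<rho> k then 1 else -1)"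
  have \<sigma>: "\<sigma> \<in> {-1, 1}" "\<sigma> * a k = \<rho> k"
    using k by (auto simp: \<sigma>_def)
  have "\<forall>i\<in>I. 0 < \<rho> i + \<sigma> * a i"
  proof
    fix i assume i: "i \<in> I"
    show "0 < \<rho> i + \<sigma> * a i"
      using bspec[OF bspec[OF less k(1)] i] bspec[OF le i] \<sigma> by auto
  qed
  from finite_positive_lower_bound[OF \<open>finite I\<close> this]
  obtain \<delta> where "0 < \<delta>" and \<delta>: "\<forall>i\<in>I. \<delta> < \<rho> i + \<sigma> * a i"
    by auto
  show thesis
  proof (rule contact[OF \<open>0 < \<delta>\<close> \<sigma>(1) k(1) \<sigma>(2)])
    show "\<bar>a i - \<sigma> * \<epsilon>\<bar> < \<rho> i" if "i \<in> I" "0 < \<epsilon>" "\<epsilon> \<le> \<delta>" for i \<epsilon>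
      using bspec[OF le that(1)] bspec[OF \<delta> that(1)] that(2,3) \<sigma>(1) by auto
  qed
qed

text \<open>The local step: a common point of the balls of radii \<open>\<rho>\<^sub>i\<close> can be moved, inside \<open>A\<close>, to a
  common interior point, as long as the radii are larger than needed by some \<open>t > 0\<close>.\<close>

lemma descent:
  assumes A: "geodesic_subset A" "y \<in> A"
    and I: "finite I" "\<And>i. i \<in> I \<Longrightarrow> x i \<in> A"
    and le: "\<And>i. i \<in> I \<Longrightarrow> dmax (x i) y \<le> \<rho> i"
    and "0 < t"
    and gap: "\<And>i j. i \<in> I \<Longrightarrow> j \<in> I \<Longrightarrow> dmax (x i) (x j) \<le> \<rho> i + \<rho> j - 2 * t"
  shows "\<exists>z\<in>A. \<forall>i\<in>I. dmax (x i) z < \<rho> i"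
proof -
  define a where "a i = fst (x i) - fst y" for i
  define b where "b i = snd (x i) - snd y" for i
  have moved: "dmax (x i) z < \<rho> i"
    if "\<bar>a i - (fst z - fst y)\<bar> < \<rho> i" "\<bar>b i - (snd z - snd y)\<bar> < \<rho> i" for i z
    using that by (simp add: dmax_def a_def b_def)
  have a: "\<forall>i\<in>I. \<bar>a i\<bar> \<le> \<rho> i" and b: "\<forall>i\<in>I. \<bar>b i\<bar> \<le> \<rho> i"
    using order_trans[OF abs_fst_le_dmax le] order_trans[OF abs_snd_le_dmax le]
    by (simp_all add: a_def b_def)
  have gap': "dmax (x i) (x j) < \<rho> i + \<rho> j" if "i \<in> I" "j \<in> I" for i j
    using gap[OF that] \<open>0 < t\<close> by simp
  have ad: "\<forall>i\<in>I. \<forall>j\<in>I. \<bar>a i - a j\<bar> < \<rho> i + \<rho> j"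
    and bd: "\<forall>i\<in>I. \<forall>j\<in>I. \<bar>b i - b j\<bar> < \<rho> i + \<rho> j"
    using order_le_less_trans[OF abs_fst_le_dmax gap'] order_le_less_trans[OF abs_snd_le_dmax gap']
    by (simp_all add: a_def b_def)
  \<comment> \<open>A ball that touches \<open>y\<close> with one of its sides has \<open>y\<close> at distance exactly its radius.\<close>
  have dist_a: "dmax (x k) y = \<rho> k \<and> t \<le> \<rho> k"
    if "k \<in> I" "\<sigma> \<in> {-1, 1}" "\<sigma> * a k = \<rho> k" for k \<sigma>
    using le[OF that(1)] gap[OF that(1,1)] abs_fst_le_dmax[of "x k" y] that by (auto simp: a_def)
  have dist_b: "dmax (x k) y = \<rho> k \<and> t \<le> \<rho> k"
    if "k \<in> I" "\<tau> \<in> {-1, 1}" "\<tau> * b k = \<rho> k" for k \<tau>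
    using le[OF that(1)] gap[OF that(1,1)] abs_snd_le_dmax[of "x k" y] that by (auto simp: b_def)
  show ?thesis
  proof (cases rule: one_dimensional_contact[OF I(1) a ad, case_names int_a con_a])
    case (int_a \<delta>)
    show ?thesis
    proof (cases rule: one_dimensional_contact[OF I(1) b bd, case_names int_b con_b])
      case (int_b \<delta>')
      have "dmax (x i) y < \<rho> i" if "i \<in> I" for i
        using int_a(1) int_b(1) int_a(2)[OF that, of 0] int_b(2)[OF that, of 0]
        by (intro moved) simp_all
      with A(2) show ?thesis by blast
    next
      case (con_b \<tau> \<delta>' k)
      define \<epsilon> where "\<epsilon> = min t (min \<delta> \<delta>')"
      have \<epsilon>: "0 < \<epsilon>" "\<epsilon> \<le> t" "\<epsilon> \<le> \<delta>" "\<epsilon> \<le> \<delta>'"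
        using int_a(1) con_b(1) \<open>0 < t\<close> by (auto simp: \<epsilon>_def)
      obtain z where "z \<in> A" and z: "snd z = snd y + \<tau> * \<epsilon>" "\<bar>fst z - fst y\<bar> \<le> \<epsilon>"
        using step_snd[OF A I(2)[OF con_b(3)] con_b(2), of \<epsilon>] dist_b[OF con_b(3,2,4)] con_b(4) \<epsilon>
        unfolding b_def by auto
      have "dmax (x i) z < \<rho> i" if "i \<in> I" for i
        using int_a(2)[OF that, of "fst z - fst y"] con_b(5)[OF that \<epsilon>(1,4)] z \<epsilon>(3)
        by (intro moved) simp_all
      with \<open>z \<in> A\<close> show ?thesis by blast
    qed
  next
    case (con_a \<sigma> \<delta> k)
    show ?thesis
    proof (cases rule: one_dimensional_contact[OF I(1) b bd, case_names int_b con_b])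
      case (int_b \<delta>')
      define \<epsilon> where "\<epsilon> = min t (min \<delta> \<delta>')"
      have \<epsilon>: "0 < \<epsilon>" "\<epsilon> \<le> t" "\<epsilon> \<le> \<delta>" "\<epsilon> \<le> \<delta>'"
        using con_a(1) int_b(1) \<open>0 < t\<close> by (auto simp: \<epsilon>_def)
      obtain z where "z \<in> A" and z: "fst z = fst y + \<sigma> * \<epsilon>" "\<bar>snd z - snd y\<bar> \<le> \<epsilon>"
        using step_fst[OF A I(2)[OF con_a(3)] con_a(2), of \<epsilon>] dist_a[OF con_a(3,2,4)] con_a(4) \<epsilon>
        unfolding a_def by auto
      have "dmax (x i) z < \<rho> i" if "i \<in> I" for i
        using int_b(2)[OF that, of "snd z - snd y"] con_a(5)[OF that \<epsilon>(1,3)] z \<epsilon>(4)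
        by (intro moved) simp_all
      with \<open>z \<in> A\<close> show ?thesis by blast
    next
      case (con_b \<tau> \<delta>' l)
      define \<epsilon> where "\<epsilon> = min t (min \<delta> \<delta>')"
      have \<epsilon>: "0 < \<epsilon>" "\<epsilon> \<le> t" "\<epsilon> \<le> \<delta>" "\<epsilon> \<le> \<delta>'"
        using con_a(1) con_b(1) \<open>0 < t\<close> by (auto simp: \<epsilon>_def)
      let ?z = "(fst y + \<sigma> * \<epsilon>, snd y + \<tau> * \<epsilon>)"
      have "?z \<in> A"
      proof (rule step_diagonal[OF A I(2)[OF con_a(3)] I(2)[OF con_b(3)] con_a(2) con_b(2)])
        show "\<sigma> * (fst (x k) - fst y) = dmax (x k) y"
          using con_a(4) dist_a[OF con_a(3,2,4)] by (simp add: a_def)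
        show "\<tau> * (snd (x l) - snd y) = dmax (x l) y"
          using con_b(4) dist_b[OF con_b(3,2,4)] by (simp add: b_def)
        show "dmax (x k) (x l) \<le> dmax (x k) y + dmax (x l) y - 2 * t"
          using gap[OF con_a(3) con_b(3)] dist_a[OF con_a(3,2,4)] dist_b[OF con_b(3,2,4)] by simp
      qed (use \<epsilon> in auto)
      moreover have "dmax (x i) ?z < \<rho> i" if "i \<in> I" for i
        using con_a(5)[OF that \<epsilon>(1,3)] con_b(5)[OF that \<epsilon>(1,4)]
        by (intro moved) simp_all
      ultimately show ?thesis by blast
    qed
  qed
qed

section \<open>Hyperconvexity\<close>

lemma closed_dmax_cball: "closed {z. dmax c z \<le> r}"
  by (intro closed_Collect_le continuous_intros)

lemma bounded_dmax_cball: "bounded {z. dmax c z \<le> r}"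
proof -
  have "{z. dmax c z \<le> r} \<subseteq> cball c (2 * r)"
  proof
    fix z assume "z \<in> {z. dmax c z \<le> r}"
    then show "z \<in> cball c (2 * r)"
      using dist_le_dmax[of c z] by simp
  qed
  then show ?thesis
    by (rule bounded_subset[OF bounded_cball])
qed

text \<open>Instead of minimising \<open>max\<^sub>i (d(x\<^sub>i, z) - r\<^sub>i)\<close> over \<open>A\<close>, the proof minimises \<open>t\<close> over the pairs
  \<open>(z, t)\<close> for which \<open>z\<close> lies in all balls of radius \<open>r\<^sub>i + t\<close>; this avoids a maximum of continuous
  functions.\<close>

lemma finite_balls_intersect:
  assumes A: "closed A" "geodesic_subset A" "A \<noteq> {}"
    and I: "finite I" "\<And>i. i \<in> I \<Longrightarrow> x i \<in> A"
    and r: "\<And>i j. i \<in> I \<Longrightarrow> j \<in> I \<Longrightarrow> dmax (x i) (x j) \<le> r i + r j"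
  shows "\<exists>z\<in>A. \<forall>i\<in>I. dmax (x i) z \<le> r i"
proof (cases "I = {}")
  case True
  with A(3) show ?thesis by auto
next
  case False
  then obtain k where k: "k \<in> I" by blast
  define T where "T = (\<Sum>i\<in>I. dmax (x i) (x k))"
  have T: "dmax (x i) (x k) \<le> T" if "i \<in> I" for i
    unfolding T_def using that I(1) by (intro member_le_sum) auto
  have r_nonneg: "0 \<le> r i" if "i \<in> I" for i
    using r[OF that that] by simp
  define K where "K = (A \<times> {0..T}) \<inter> (\<Inter>i\<in>I. {w. dmax (x i) (fst w) \<le> r i + snd w})"
  have "closed K"
    unfolding K_def
    by (intro closed_Int closed_INT ballI closed_Times A(1) closed_atLeastAtMost closed_Collect_le continuous_intros)
  moreover have "bounded K"
  proof (rule bounded_subset)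
    show "bounded ({z. dmax (x k) z \<le> r k + T} \<times> {0..T})"
      by (intro bounded_Times bounded_dmax_cball) auto
    show "K \<subseteq> {z. dmax (x k) z \<le> r k + T} \<times> {0..T}"
      using k by (force simp: K_def)
  qed
  ultimately have "compact K"
    by (simp add: compact_eq_bounded_closed)
  moreover have "(x k, T) \<in> K"
    using T I k r_nonneg by (force simp: K_def T_def intro: sum_nonneg)
  ultimately obtain w where w: "w \<in> K" and min: "\<And>w'. w' \<in> K \<Longrightarrow> snd w \<le> snd w'"
    using continuous_attains_inf[of K snd] continuous_on_snd[OF continuous_on_id] by blast
  obtain y t where yt: "w = (y, t)" by fastforce
  have y: "y \<in> A" "0 \<le> t" "t \<le> T" "\<And>i. i \<in> I \<Longrightarrow> dmax (x i) y \<le> r i + t"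
    using w by (auto simp: K_def yt)
  have "t = 0"
  proof (rule ccontr)
    assume "t \<noteq> 0"
    with y(2) have "0 < t" by simp
    have "\<exists>z\<in>A. \<forall>i\<in>I. dmax (x i) z < r i + t"
      by (rule descent[OF A(2) y(1) I y(4) \<open>0 < t\<close>]) (use r in force)+
    then obtain z where z: "z \<in> A" "\<forall>i\<in>I. 0 < r i + t - dmax (x i) z"
      by auto
    obtain \<delta> where \<delta>: "0 < \<delta>" "\<forall>i\<in>I. \<delta> < r i + t - dmax (x i) z"
      using finite_positive_lower_bound[OF I(1) z(2)] by blast
    define t' where "t' = max 0 (t - \<delta>)"
    have "dmax (x i) z \<le> r i + t'" if "i \<in> I" for i
      using bspec[OF \<delta>(2) that] by (simp add: t'_def)
    moreover have "0 \<le> t'" "t' < t"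
      using \<delta>(1) \<open>0 < t\<close> by (auto simp: t'_def)
    ultimately have "(z, t') \<in> K"
      using z(1) y(3) by (auto simp: K_def)
    with min \<open>t' < t\<close> yt show False
      by fastforce
  qed
  with y show ?thesis by auto
qed

lemma balls_intersect:
  assumes A: "closed A" "geodesic_subset A" "A \<noteq> {}"
    and x: "\<And>i. i \<in> I \<Longrightarrow> x i \<in> A"
    and r: "\<And>i j. i \<in> I \<Longrightarrow> j \<in> I \<Longrightarrow> dmax (x i) (x j) \<le> r i + r j"
  shows "A \<inter> (\<Inter>i\<in>I. {z. dmax (x i) z \<le> r i}) \<noteq> {}"
proof (cases "I = {}")
  case True
  with A(3) show ?thesis by auto
next
  case False
  then obtain k where k: "k \<in> I" by blast
  \<comment> \<open>The closed set \<open>A\<close> need not be compact; its intersection with one of the balls is.\<close>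
  let ?B = "\<lambda>i. {z. dmax (x i) z \<le> r i}"
  have "(A \<inter> ?B k) \<inter> (\<Inter>i\<in>I. ?B i) \<noteq> {}"
  proof (rule compact_imp_fip_image)
    show "compact (A \<inter> ?B k)"
      using A(1) closed_dmax_cball bounded_dmax_cball
      by (simp add: compact_eq_bounded_closed closed_Int bounded_Int)
  next
    fix J assume J: "finite J" "J \<subseteq> I"
    have "\<exists>z\<in>A. \<forall>i\<in>insert k J. dmax (x i) z \<le> r i"
      by (rule finite_balls_intersect[OF A]) (use J k x r in \<open>auto simp: subset_iff\<close>)
    then show "(A \<inter> ?B k) \<inter> (\<Inter>i\<in>J. ?B i) \<noteq> {}"
      by auto
  qed (rule closed_dmax_cball)
  then show ?thesis by blast
qed

theorem theorem3:
  fixes A :: "(real \<times> real) set"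
  assumes "A \<noteq> {}"
    and "closedin (Metric_space.mtopology UNIV dmax) A"
    and "Metric_space.geodesically_convex UNIV dmax A"
  shows "Metric_space.hyperconvex A dmax"
proof -
  interpret A: Metric_space A dmax
    by (rule dmax.subspace) simp
  have A: "closed A" "geodesic_subset A"
    using assms closed_if_closedin_dmax geodesic_subset_if_geodesically_convex by auto
  show ?thesis
    unfolding A.hyperconvex_def
  proof (intro allI impI)
    fix I :: "((real \<times> real) \<times> real) set" and x r
    assume x: "\<forall>i\<in>I. x i \<in> A \<and> 0 \<le> r i"
      and r: "\<forall>i\<in>I. \<forall>j\<in>I. dmax (x i) (x j) \<le> r i + r j"
    have "A \<inter> (\<Inter>i\<in>I. {z. dmax (x i) z \<le> r i}) \<noteq> {}"
      by (rule balls_intersect[OF A assms(1)]) (use x r in auto)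
    then show "A \<inter> (\<Inter>i\<in>I. A.mcball (x i) (r i)) \<noteq> {}"
      using x by (fastforce simp: A.in_mcball)
  qed
qed

end
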